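(* Let $A, E, F\in\mathbb{C}^{n\times n}$ with $E$ and $F$ invertible and Hermitian, and let $\mathrm{ind}(A)=k$. Let $m\geq k$ be an integer. If $(A^m)^\dagger_{E,F}$ exists, then: (i) $A^{\mathrm{ep},E}=A^DA^m(A^m)^{\dagger}_{E,I}$. (ii) $AA^{\mathrm{ep},E}=A^mX=A^m(A^m)^{\dagger}_{E,I}$ for $X\in A^m\{1,3^E\}$. (iii) $A^{F,\mathrm{ep}}=(A^m)^{\dagger}_{I,F}A^mA^D$. (iv) $A^{F,\mathrm{ep}}A=YA^m=(A^m)^{\dagger}_{I,F}A^m$ for $Y\in A^m\{1,4^F\}$.
   Context: The index $\mathrm{ind}(A)$ is the smallest non-negative integer $k$ with $\mathrm{rank}(A^k)=\mathrm{rank}(A^{k+1})$ (with $A^0=I$). $A^D$ is the Drazin inverse of $A$: the unique $X$ with $XA^{k+1}=A^k$, $XAX=X$, $AX=XA$. For invertible Hermitian $E,F$ and a square matrix $B$: $B^\dagger_{E,F}$ (generalized weighted Moore-Penrose inverse) is the matrix $Y$, unique when it exists, with $BYB=B$, $YBY=Y$, $(EBY)^*=EBY$, $(FYB)^*=FYB$; $B\{1,3^E\}$ is the set of $Y$ with $BYB=B$ and $(EBY)^*=EBY$; $B\{1,4^F\}$ is the set of $Y$ with $BYB=B$ and $(FYB)^*=FYB$. $I$ is the identity matrix. With $k=\mathrm{ind}(A)$: the $E$-weighted core-EP inverse $A^{\mathrm{ep},E}$ is the matrix $X\in\mathbb{C}^{n\times n}$ (unique when it exists) with $XA^{k+1}=A^k$,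 $AX^2=X$, $(EAX)^*=EAX$; the $F$-weighted dual core-EP inverse $A^{F,\mathrm{ep}}$ is the matrix $X\in\mathbb{C}^{n\times n}$ (unique when it exists) with $A^{k+1}X=A^k$, $X^2A=X$, $(FXA)^*=FXA$. The equalities are understood to include the assertion that the inverses appearing in them exist. *)

theory Defs
  imports "HOL-Analysis.Analysis"
begin

text \<open>Multiplication and power of the type class instances on \<^typ>\<open>complex^'n^'n\<close> are
  componentwise, so matrix powers are defined from the matrix product \<open>**\<close>.\<close>

primrec matpow :: "complex^'n^'n \<Rightarrow> nat \<Rightarrow> complex^'n^'n" where
  "matpow A 0 = mat 1"
| "matpow A (Suc k) = A ** matpow A k"

definition ctranspose :: "complex^'n^'m \<Rightarrow> complex^'m^'n" where
  "ctranspose A = (\<chi> i j. cnj (A $ j $ i))"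

definition hermitian :: "complex^'n^'n \<Rightarrow> bool" where
  "hermitian A \<longleftrightarrow> ctranspose A = A"

definition ind :: "complex^'n^'n \<Rightarrow> nat" where
  "ind A = (LEAST k. rank (matpow A k) = rank (matpow A (k + 1)))"

text \<open>Each inverse is given by a predicate (its defining equations) and a \<open>THE\<close>-term denoting the
  matrix satisfying it. The term is meaningful only when such a matrix exists, so existence has to
  be asserted separately, through the predicate.\<close>

definition is_drazin_inverse :: "complex^'n^'n \<Rightarrow> complex^'n^'n \<Rightarrow> bool" where
  "is_drazin_inverse A X \<longleftrightarrow>
     X ** matpow A (ind A + 1) = matpow A (ind A) \<and> X ** A ** X = X \<and> A ** X = X ** A"

definition drazin_inverse :: "complex^'n^'n \<Rightarrow> complex^'n^'n" where
  "drazin_inverse A = (THE X. is_drazin_inverse A X)"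

definition is_weighted_MP_inverse ::
    "complex^'n^'n \<Rightarrow> complex^'n^'n \<Rightarrow> complex^'n^'n \<Rightarrow> complex^'n^'n \<Rightarrow> bool" where
  "is_weighted_MP_inverse E F B Y \<longleftrightarrow>
     B ** Y ** B = B \<and> Y ** B ** Y = Y \<and> hermitian (E ** B ** Y) \<and> hermitian (F ** Y ** B)"

definition weighted_MP_inverse ::
    "complex^'n^'n \<Rightarrow> complex^'n^'n \<Rightarrow> complex^'n^'n \<Rightarrow> complex^'n^'n" where
  "weighted_MP_inverse E F B = (THE Y. is_weighted_MP_inverse E F B Y)"

definition inverses_13 :: "complex^'n^'n \<Rightarrow> complex^'n^'n \<Rightarrow> (complex^'n^'n) set" where
  "inverses_13 E B = {Y. B ** Y ** B = B \<and> hermitian (E ** B ** Y)}"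

definition inverses_14 :: "complex^'n^'n \<Rightarrow> complex^'n^'n \<Rightarrow> (complex^'n^'n) set" where
  "inverses_14 F B = {Y. B ** Y ** B = B \<and> hermitian (F ** Y ** B)}"

definition is_core_EP_inverse ::
    "complex^'n^'n \<Rightarrow> complex^'n^'n \<Rightarrow> complex^'n^'n \<Rightarrow> bool" where
  "is_core_EP_inverse E A X \<longleftrightarrow>
     X ** matpow A (ind A + 1) = matpow A (ind A) \<and> A ** matpow X 2 = X \<and>
     hermitian (E ** A ** X)"

definition core_EP_inverse :: "complex^'n^'n \<Rightarrow> complex^'n^'n \<Rightarrow> complex^'n^'n" where
  "core_EP_inverse E A = (THE X. is_core_EP_inverse E A X)"

definition is_dual_core_EP_inverse ::
    "complex^'n^'n \<Rightarrow> complex^'n^'n \<Rightarrow> complex^'n^'n \<Rightarrow> bool" where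
  "is_dual_core_EP_inverse F A X \<longleftrightarrow>
     matpow A (ind A + 1) ** X = matpow A (ind A) \<and> matpow X 2 ** A = X \<and>
     hermitian (F ** X ** A)"

definition dual_core_EP_inverse :: "complex^'n^'n \<Rightarrow> complex^'n^'n \<Rightarrow> complex^'n^'n" where
  "dual_core_EP_inverse F A = (THE X. is_dual_core_EP_inverse F A X)"

end

theory Submission
  imports Defs
begin

text \<open>For \<open>m \<ge> ind A\<close> the range of \<open>A^m\<close> is that of \<open>A^(ind A)\<close>, so \<open>A ** X\<close> for a core-EP inverse \<open>X\<close>
  and \<open>A^m ** Z\<close> for \<open>Z\<close> in \<open>A^m{1,3^E}\<close> are idempotents with this same range, self-adjoint with
  respect to \<open>E\<close>. Such an idempotent is unique even for indefinite \<open>E\<close>, and \<open>D ** A^m ** Z\<close>, with \<open>D\<close> the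
  Drazin inverse, satisfies the core-EP equations. The hypothesis enters only through \<open>A^m{1,3^E}\<close> and
  \<open>A^m{1,4^F}\<close> being nonempty; the identity weights are served by the ordinary Moore-Penrose inverse,
  which exists for every complex matrix. Plain transposition, which replaces the
  weight \<open>F\<close> by the transpose of its inverse, reduces the dual claims to these.\<close>

section \<open>Ranges, ranks and factorisations of matrices over a field\<close>

text \<open>\<open>rank\<close> unfolds to the dimension of the row space. Viewing that space as a
  range makes rank conditions accessible to inclusions of ranges and, through these, to matrix
  factorisations.\<close>

lemma row_space_eq_range:
  fixes M :: "'a::field^'n^'m"
  shows "vec.span (rows M) = range ((*v) (transpose M))"
proof
  have "x \<in> range ((*v) (transpose M))" if x: "x \<in> rows M" for x
  proof -
    obtain i where "x = row i M" using x by (auto simp: rows_def)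
    then have "x = transpose M *v axis i 1"
      by (simp add: vec_eq_iff row_def transpose_def matrix_vector_mult_def axis_def if_distrib
          cong: if_cong)
    then show ?thesis by blast
  qed
  moreover have "vec.subspace (range ((*v) (transpose M)))"
    by (intro vec.subspace_image vec.subspace_UNIV)
  ultimately show "vec.span (rows M) \<subseteq> range ((*v) (transpose M))"
    by (intro vec.span_minimal) auto
  show "range ((*v) (transpose M)) \<subseteq> vec.span (rows M)"
    using matrix_vector_mult_in_columnspace_gen[of "transpose M"] by auto
qed

text \<open>\<open>G\<close> is the matrix of a linear section of \<open>M\<close> over its
  range.\<close>

lemma exists_inner_inverse:
  fixes M :: "'a::field^'n^'m"
  shows "\<exists>G. M ** G ** M = M"
proof -
  obtain g where g: "Vector_Spaces.linear (*s) (*s) g" "\<And>v. v \<in> range ((*v) M) \<Longrightarrow> M *v g v = v"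
    using vec.linear_exists_right_inverse_on[OF matrix_vector_mul_linear_gen[of M] vec.subspace_UNIV]
    by blast
  have "M ** matrix g ** M = M"
    unfolding matrix_eq using g by (simp add: matrix_vector_mul_assoc[symmetric] matrix_works)
  then show ?thesis by blast
qed

text \<open>For an inner inverse \<open>G\<close> of \<open>M\<close>, the product
  \<open>M ** G\<close> fixes the range of \<open>M\<close> pointwise, so \<open>G ** N\<close>
  serves as the factor.\<close>

lemma right_factor_of_range_subset:
  fixes M :: "'a::field^'n^'m" and N :: "'a^'p^'m"
  assumes "range ((*v) N) \<subseteq> range ((*v) M)"
  shows "\<exists>W. N = M ** W"
proof -
  obtain G where G: "M ** G ** M = M" using exists_inner_inverse by blast
  have "M *v (G *v (N *v x)) = N *v x" for x
  proof -
    obtain y where y: "N *v x = M *v y" using assms by blast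
    show ?thesis unfolding y using G by (simp add: matrix_vector_mul_assoc matrix_mul_assoc)
  qed
  then have "N = M ** (G ** N)"
    unfolding matrix_eq by (simp add: matrix_vector_mul_assoc[symmetric])
  then show ?thesis by blast
qed

lemma range_mult_subset: "range ((*v) (M ** N)) \<subseteq> range ((*v) M)"
  by (auto simp: matrix_vector_mul_assoc[symmetric])

text \<open>The row space of \<open>A ** B\<close> always lies in that of \<open>B\<close>, so equal
  ranks force equal row spaces, and transposing turns this into a left factor. With \<open>B\<close>
  a power of \<open>A\<close>, the rank condition in \<open>ind\<close> becomes the solvability of a
  matrix equation.\<close>

lemma rank_mult_eq_iff:
  fixes A :: "'a::field^'n^'m" and B :: "'a^'p^'n"
  shows "rank B = rank (A ** B) \<longleftrightarrow> (\<exists>V. B = V ** (A ** B))"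
proof
  have sub: "vec.span (rows (A ** B)) \<subseteq> vec.span (rows B)"
    unfolding row_space_eq_range matrix_transpose_mul by (rule range_mult_subset)
  {
    assume "rank B = rank (A ** B)"
    then have "vec.span (rows (A ** B)) = vec.span (rows B)"
      unfolding row_rank_def_gen using sub
      by (intro vec.subspace_dim_equal) (auto simp: vec.dim_span)
    then have "range ((*v) (transpose B)) \<subseteq> range ((*v) (transpose (A ** B)))"
      by (simp add: row_space_eq_range)
    then obtain W where "transpose B = transpose (A ** B) ** W"
      using right_factor_of_range_subset by blast
    then have "B = transpose W ** (A ** B)"
      by (metis matrix_transpose_mul transpose_transpose)
    then show "\<exists>V. B = V ** (A ** B)" by blast
  }
  assume "\<exists>V. B = V ** (A ** B)"
  then obtain V where V: "B = V ** (A ** B)" by blast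
  have "vec.span (rows (V ** (A ** B))) \<subseteq> vec.span (rows (A ** B))"
    unfolding row_space_eq_range matrix_transpose_mul[of V] by (rule range_mult_subset)
  then have "vec.span (rows B) \<subseteq> vec.span (rows (A ** B))" using V by simp
  then have "vec.span (rows B) = vec.span (rows (A ** B))" using sub by blast
  then show "rank B = rank (A ** B)"
    unfolding row_rank_def_gen by (metis vec.dim_span)
qed

text \<open>Left multiplication by \<open>A\<close> is injective on the finite-dimensional range of \<open>B\<close> and maps it to
  itself, hence is onto.\<close>

lemma right_factor_of_left_factor:
  fixes A B :: "'a::field^'n^'n"
  assumes "A ** B = B ** A" and V: "B = V ** (A ** B)"
  shows "\<exists>W. B = A ** B ** W"
proof -
  let ?U = "range ((*v) B)"
  have sU: "vec.subspace ?U" by (intro vec.subspace_image vec.subspace_UNIV)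
  have im: "(*v) A ` ?U = range ((*v) (A ** B))"
    by (simp add: image_image matrix_vector_mul_assoc)
  have "V *v (A *v x) = x" if "x \<in> ?U" for x
    using that V by (auto simp: matrix_vector_mul_assoc matrix_mul_assoc)
  then have "inj_on ((*v) A) ?U" by (rule inj_on_inverseI)
  then have "vec.dim ((*v) A ` ?U) = vec.dim ?U"
    using sU by (intro vec.dim_image_eq) (auto simp: vec.span_eq_iff[THEN iffD2])
  moreover have "(*v) A ` ?U \<subseteq> ?U"
    unfolding im assms(1) by (rule range_mult_subset)
  ultimately have "(*v) A ` ?U = ?U"
    using sU by (intro vec.subspace_dim_equal) (auto intro: vec.subspace_image)
  then show ?thesis
    unfolding im by (intro right_factor_of_range_subset) simp
qed

section \<open>Matrix powers and the index\<close>

lemma matpow_add: "matpow A (i + j) = matpow A i ** matpow A j"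
  by (induction i) (simp_all add: matrix_mul_assoc)

lemma matpow_commute:
  assumes "X ** A = A ** X"
  shows "X ** matpow A k = matpow A k ** X"
proof (induction k)
  case (Suc k)
  have "X ** matpow A (Suc k) = A ** (X ** matpow A k)"
    by (simp add: matrix_mul_assoc assms)
  then show ?case by (simp add: Suc.IH matrix_mul_assoc)
qed simp

lemma matpow_Suc_right: "matpow A (Suc k) = matpow A k ** A"
  by (simp add: matpow_commute)

lemma matpow_2: "matpow A 2 = A ** A"
  by (simp add: numeral_2_eq_2)

lemma transpose_matpow: "transpose (matpow A k) = matpow (transpose A) k"
proof (induction k)
  case (Suc k)
  then show ?case by (simp add: matrix_transpose_mul matpow_commute)
qed simp

lemma rank_matpow_eq_iff:
  "rank (matpow A k) = rank (matpow A (k + 1)) \<longleftrightarrow> (\<exists>V. matpow A k = V ** matpow A (k + 1))"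
  using rank_mult_eq_iff[of "matpow A k" A] by simp

text \<open>From left to right this is \<open>right_factor_of_left_factor\<close>, since
  \<open>A\<close> commutes with its powers; the converse is the same implication for the transpose
  of \<open>A\<close>.\<close>

lemma left_right_factor_matpow_iff:
  "(\<exists>V. matpow A k = V ** matpow A (k + 1)) \<longleftrightarrow> (\<exists>W. matpow A k = matpow A (k + 1) ** W)"
proof -
  have lr: "\<exists>W. matpow A k = matpow A (k + 1) ** W" if "matpow A k = V ** matpow A (k + 1)"
    for A V :: "complex^'n^'n"
    using right_factor_of_left_factor[OF matpow_commute[OF refl]
        that[folded Suc_eq_plus1, unfolded matpow.simps(2)]] by simp
  have "\<exists>V. matpow A k = V ** matpow A (k + 1)" if "matpow A k = matpow A (k + 1) ** W" for W
  proof -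
    have "matpow (transpose A) k = transpose W ** matpow (transpose A) (k + 1)"
      using that by (metis matrix_transpose_mul transpose_matpow)
    then obtain W' where "matpow (transpose A) k = matpow (transpose A) (k + 1) ** W'"
      using lr by blast
    then have "matpow A k = transpose W' ** matpow A (k + 1)"
      by (metis matrix_transpose_mul transpose_matpow transpose_transpose)
    then show ?thesis by blast
  qed
  then show ?thesis using lr by blast
qed

text \<open>Transposition exchanges left and right factors, and solvability on the two sides is
  equivalent.\<close>

lemma ind_transpose: "ind (transpose A) = ind A"
proof -
  have "(\<exists>V. matpow (transpose A) k = V ** matpow (transpose A) (k + 1)) \<longleftrightarrow>
      (\<exists>W. matpow A k = matpow A (k + 1) ** W)" for k
    by (metis matrix_transpose_mul transpose_matpow transpose_transpose)
  then show ?thesis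
    unfolding ind_def rank_matpow_eq_iff using left_right_factor_matpow_iff[of A] by simp
qed

text \<open>The \<open>LEAST\<close> in \<open>ind\<close> is meaningful only if the ranks of the
  powers become stationary. They never increase, and a strict decrease at every step would exhaust
  the initial rank.\<close>

lemma rank_ind: "rank (matpow A (ind A)) = rank (matpow A (ind A + 1))"
proof -
  have le: "rank (matpow A (k + 1)) \<le> rank (matpow A k)" for k
  proof -
    have "vec.span (rows (A ** matpow A k)) \<subseteq> vec.span (rows (matpow A k))"
      unfolding row_space_eq_range matrix_transpose_mul by (rule range_mult_subset)
    then show ?thesis
      unfolding row_rank_def_gen
      by (metis Suc_eq_plus1 matpow.simps(2) vec.dim_span vec.dim_subset)
  qed
  have "\<exists>k. rank (matpow A k) = rank (matpow A (k + 1))"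
  proof (rule ccontr)
    assume "\<not> ?thesis"
    then have lt: "rank (matpow A (k + 1)) < rank (matpow A k)" for k
      using le[of k] by (metis le_neq_implies_less)
    have "rank (matpow A k) + k \<le> rank (matpow A 0)" for k
    proof (induction k)
      case (Suc k)
      then show ?case using lt[of k] by simp
    qed simp
    from this[of "Suc (rank (matpow A 0))"] show False by simp
  qed
  then show ?thesis unfolding ind_def by (rule LeastI_ex)
qed

section \<open>Existence and uniqueness of the Drazin inverse\<close>

text \<open>The index supplies a left factor \<open>V\<close> and a right factor \<open>W\<close>
  with \<open>A^k = V A^(k+1) = A^(k+1) W\<close>. The candidate has the two forms
  \<open>A^k W^(k+1)\<close> and \<open>V^(k+1) A^k\<close>; the first evaluates
  \<open>A ** X\<close>, the second \<open>X ** A\<close>, and the results agree.\<close>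

lemma drazin_inverse_exists: "\<exists>D. is_drazin_inverse A D"
proof -
  define k where "k = ind A"
  obtain V where V: "matpow A k = V ** matpow A (k + 1)"
    using rank_ind[of A] unfolding rank_matpow_eq_iff k_def by blast
  then obtain W where W: "matpow A k = matpow A (k + 1) ** W"
    using left_right_factor_matpow_iff by blast
  have VV: "matpow A (k + j) = V ** matpow A (k + j + 1)" for j
    using arg_cong[OF V, of "\<lambda>M. M ** matpow A j"]
    by (simp add: matpow_add[symmetric] matrix_mul_assoc[symmetric] add.commute del: matpow.simps)
  have WW: "matpow A (j + k) = matpow A (j + k + 1) ** W" for j
    using arg_cong[OF W, of "\<lambda>M. matpow A j ** M"]
    by (simp add: matpow_add[symmetric] matrix_mul_assoc del: matpow.simps)
  have Vj: "matpow V j ** matpow A (k + j) = matpow A k" for j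
  proof (induction j)
    case (Suc j)
    have "matpow V (Suc j) ** matpow A (k + Suc j) = matpow V j ** (V ** matpow A (k + j + 1))"
      by (simp only: matpow_Suc_right[of V] matrix_mul_assoc add_Suc_right Suc_eq_plus1[symmetric])
    then show ?case by (simp only: VV[symmetric] Suc.IH)
  qed simp
  have Wj: "matpow A (j + k) ** matpow W j = matpow A k" for j
  proof (induction j)
    case (Suc j)
    have "matpow A (Suc j + k) ** matpow W (Suc j) = matpow A (j + k + 1) ** W ** matpow W j"
      by (simp only: matpow.simps(2)[of W] matrix_mul_assoc add_Suc Suc_eq_plus1[symmetric])
    then show ?case by (simp only: WW[symmetric] Suc.IH)
  qed simp
  \<comment> \<open>The product \<open>V^j A^(k+j) W^j\<close> collapses from either side, by
    \<open>Vj\<close> or by \<open>Wj\<close>.\<close>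
  have VW: "matpow V j ** matpow A k = matpow A k ** matpow W j" for j
  proof -
    have "matpow V j ** (matpow A (j + k) ** matpow W j) = matpow V j ** matpow A (k + j) ** matpow W j"
      by (simp add: matrix_mul_assoc add.commute)
    then show ?thesis by (simp add: Vj Wj)
  qed
  define X where "X = matpow A k ** matpow W (k + 1)"
  have X': "X = matpow V (k + 1) ** matpow A k" unfolding X_def VW ..
  have AX: "A ** X = matpow A k ** matpow W k"
  proof -
    have "A ** X = matpow A (0 + k + 1) ** W ** matpow W k"
      by (simp add: X_def matrix_mul_assoc)
    then show ?thesis by (simp only: W[symmetric] add_0)
  qed
  have XA: "X ** A = matpow V k ** matpow A k"
  proof -
    have "X ** A = matpow V k ** (V ** matpow A (k + 0 + 1))"
      by (simp only: X' matpow_Suc_right Suc_eq_plus1[symmetric] matrix_mul_assoc add_0_right)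
    then show ?thesis by (simp only: V[symmetric] add_0_right)
  qed
  have "X ** matpow A (k + 1) = matpow A k"
  proof -
    have "X ** matpow A (k + 1) = X ** A ** matpow A k" by (simp add: matrix_mul_assoc)
    also have "\<dots> = matpow V k ** matpow A (k + k)"
      by (simp add: XA matpow_add matrix_mul_assoc)
    finally show ?thesis by (simp add: Vj)
  qed
  moreover have "X ** A ** X = X"
  proof -
    have "X ** A ** X = matpow V k ** matpow A k ** X" by (simp only: XA)
    also have "\<dots> = matpow V k ** matpow A (k + k) ** matpow W (k + 1)"
      by (simp only: X_def matpow_add[of A] matrix_mul_assoc)
    finally show ?thesis by (simp only: Vj X_def)
  qed
  moreover have "A ** X = X ** A" unfolding AX XA VW ..
  ultimately show ?thesis unfolding is_drazin_inverse_def k_def by blast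
qed

context
  fixes A D :: "complex^'n^'n"
  assumes D: "is_drazin_inverse A D"
begin

lemma drazin_commute: "D ** A = A ** D"
  using D by (simp add: is_drazin_inverse_def)

lemma drazin_matpow_Suc:
  assumes "ind A \<le> m"
  shows "D ** matpow A (Suc m) = matpow A m"
proof -
  obtain j where "m = ind A + j" using assms le_iff_add by blast
  then show ?thesis
    using D matpow_add[of A "ind A + 1" j] matpow_add[of A "ind A" j]
    by (simp add: is_drazin_inverse_def matrix_mul_assoc)
qed

lemma matpow_drazin_matpow:
  assumes "ind A \<le> m"
  shows "matpow A (m + j) ** matpow D j = matpow A m"
proof (induction j)
  case (Suc j)
  have "matpow A (m + Suc j) ** matpow D (Suc j) = matpow A (Suc (m + j)) ** D ** matpow D j"
    by (simp add: matrix_mul_assoc)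
  also have "matpow A (Suc (m + j)) ** D = matpow A (m + j)"
    using drazin_matpow_Suc[of "m + j"] assms matpow_commute[OF drazin_commute, of "Suc (m + j)"]
    by (simp del: matpow.simps)
  finally show ?case using Suc by simp
qed simp

end

text \<open>Each inverse factors through \<open>A^(ind A)\<close> on both sides, and
  \<open>A\<close> times the other inverse acts there as an identity. Hence
  \<open>X ** A ** Y\<close> equals both \<open>X\<close> and \<open>Y\<close>.\<close>

lemma drazin_inverse_unique:
  assumes X: "is_drazin_inverse A X" and Y: "is_drazin_inverse A Y"
  shows "X = Y"
proof -
  have fac: "X = matpow A k ** matpow X (Suc k)" if "is_drazin_inverse A X" for X k
  proof (induction k)
    case (Suc k)
    have "A ** X ** X = X" using that by (simp add: is_drazin_inverse_def)
    have "matpow A (Suc k) ** matpow X (Suc (Suc k)) = matpow A k ** (A ** X ** X) ** matpow X k"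
      by (simp only: matpow_Suc_right[of A] matpow.simps(2)[of X] matrix_mul_assoc)
    then show ?case using Suc \<open>A ** X ** X = X\<close> by (simp add: matrix_mul_assoc)
  qed simp
  have absorb: "Z ** A ** X = X" if "is_drazin_inverse A X" "is_drazin_inverse A Z" for X Z
  proof -
    have "Z ** A ** matpow A (ind A) = matpow A (ind A)"
      using drazin_matpow_Suc[OF that(2), of "ind A"] by (simp add: matrix_mul_assoc)
    then show ?thesis using fac[OF that(1), of "ind A"] by (metis matrix_mul_assoc)
  qed
  have "matpow A (ind A) ** (A ** Y) = matpow A (ind A)"
    using drazin_matpow_Suc[OF Y order_refl] matpow_commute[OF drazin_commute[OF Y], of "Suc (ind A)"]
    by (simp only: matpow_Suc_right matrix_mul_assoc)
  moreover have "X = matpow X (Suc (ind A)) ** matpow A (ind A)"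
    using fac[OF X, of "ind A"] matpow_commute[OF drazin_commute[OF X]]
      matpow_commute[of "matpow A (ind A)" X "Suc (ind A)"] by simp
  ultimately have "X ** (A ** Y) = X" by (metis matrix_mul_assoc)
  then show ?thesis using absorb[OF Y X] by (simp add: matrix_mul_assoc)
qed

section \<open>Weighted self-adjoint idempotents and weighted Moore-Penrose inverses\<close>

lemma ctranspose_mult: "ctranspose (A ** B) = ctranspose B ** ctranspose A"
  by (simp add: ctranspose_def matrix_matrix_mult_def vec_eq_iff mult.commute)

lemma ctranspose_ctranspose [simp]: "ctranspose (ctranspose A) = A"
  by (simp add: ctranspose_def vec_eq_iff)

lemma ctranspose_diff: "ctranspose (A - B) = ctranspose A - ctranspose B"
  by (simp add: ctranspose_def vec_eq_iff)

lemma ctranspose_mat_1 [simp]: "ctranspose (mat 1) = mat 1"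
  by (auto simp add: ctranspose_def vec_eq_iff mat_def)

lemma hermitian_transpose_iff: "hermitian (transpose A) \<longleftrightarrow> hermitian A"
  unfolding hermitian_def ctranspose_def transpose_def vec_eq_iff by auto

lemma invertible_mult_left_cancel:
  fixes E :: "'a::semiring_1^'n^'n"
  assumes "invertible E" and "E ** P = E ** Q"
  shows "P = Q"
  using assms unfolding invertible_def by (metis matrix_mul_assoc matrix_mul_lid)

text \<open>Moving \<open>E\<close> through both factors gives \<open>E P Q = (Q P)* E\<close>.
  Under either alternative the two sides reduce to \<open>E ** P\<close> and \<open>E ** Q\<close>,
  and \<open>E\<close> cancels. The first alternative describes idempotents with a common range, the
  second those with a common kernel.\<close>

lemma weighted_hermitian_eq:
  assumes "invertible E" "hermitian E" "hermitian (E ** P)" "hermitian (E ** Q)"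
    and PQ: "P ** Q = Q \<and> Q ** P = P \<or> P ** Q = P \<and> Q ** P = Q"
  shows "P = Q"
proof -
  have P: "ctranspose P ** E = E ** P" and Q: "ctranspose Q ** E = E ** Q"
    using assms(2-4) by (simp_all add: hermitian_def ctranspose_mult)
  have "E ** (P ** Q) = ctranspose P ** E ** Q" by (simp add: P matrix_mul_assoc)
  also have "\<dots> = ctranspose P ** (ctranspose Q ** E)" by (simp add: Q matrix_mul_assoc)
  also have "\<dots> = ctranspose (Q ** P) ** E" by (simp add: ctranspose_mult matrix_mul_assoc)
  finally have "E ** Q = E ** P" using PQ P Q by auto
  then show ?thesis using invertible_mult_left_cancel[OF assms(1)] by metis
qed

text \<open>Both products are idempotents onto the range of \<open>B\<close>.\<close>

lemma inverses_13_unique: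
  assumes "invertible E" "hermitian E" and Y: "Y \<in> inverses_13 E B" and Z: "Z \<in> inverses_13 E B"
  shows "B ** Y = B ** Z"
proof (rule weighted_hermitian_eq[OF assms(1,2)])
  show "hermitian (E ** (B ** Y))" "hermitian (E ** (B ** Z))"
    using Y Z by (simp_all add: inverses_13_def matrix_mul_assoc)
  have "B ** Y ** (B ** Z) = B ** Z" "B ** Z ** (B ** Y) = B ** Y"
    using Y Z by (simp_all add: inverses_13_def matrix_mul_assoc)
  then show "B ** Y ** (B ** Z) = B ** Z \<and> B ** Z ** (B ** Y) = B ** Y \<or>
      B ** Y ** (B ** Z) = B ** Y \<and> B ** Z ** (B ** Y) = B ** Z" by blast
qed

text \<open>Both products are idempotents with the kernel of \<open>B\<close>, hence the second
  alternative of \<open>weighted_hermitian_eq\<close>.\<close>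

lemma inverses_14_unique:
  assumes "invertible F" "hermitian F" and Y: "Y \<in> inverses_14 F B" and Z: "Z \<in> inverses_14 F B"
  shows "Y ** B = Z ** B"
proof (rule weighted_hermitian_eq[OF assms(1,2)])
  show "hermitian (F ** (Y ** B))" "hermitian (F ** (Z ** B))"
    using Y Z by (simp_all add: inverses_14_def matrix_mul_assoc)
  have "Y ** B ** (Z ** B) = Y ** B" "Z ** B ** (Y ** B) = Z ** B"
    using Y Z by (auto simp: inverses_14_def matrix_mul_assoc[symmetric])
  then show "Y ** B ** (Z ** B) = Z ** B \<and> Z ** B ** (Y ** B) = Y ** B \<or>
      Y ** B ** (Z ** B) = Y ** B \<and> Z ** B ** (Y ** B) = Z ** B" by blast
qed

lemma weighted_MP_iff:
  "is_weighted_MP_inverse E F B Y \<longleftrightarrow>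
    Y \<in> inverses_13 E B \<and> Y \<in> inverses_14 F B \<and> Y ** B ** Y = Y"
  by (auto simp: is_weighted_MP_inverse_def inverses_13_def inverses_14_def)

lemma weighted_MP_ex1:
  assumes "invertible E" "hermitian E" "invertible F" "hermitian F"
    and T: "T \<in> inverses_13 E B" and U: "U \<in> inverses_14 F B"
  shows "\<exists>!Y. is_weighted_MP_inverse E F B Y"
proof (rule ex_ex1I)
  have TU: "B ** T ** B = B" "B ** U ** B = B"
    "hermitian (E ** B ** T)" "hermitian (F ** U ** B)"
    using T U by (auto simp: inverses_13_def inverses_14_def)
  \<comment> \<open>Urquhart's formula: \<open>?Y\<close> keeps the product \<open>B ** T\<close> on
    the left and \<open>U ** B\<close> on the right, and the sandwich form adds the outer
    equation.\<close>
  let ?Y = "U ** B ** T"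
  have BY: "B ** ?Y = B ** T" and YB: "?Y ** B = U ** B"
    using TU(1,2) by (metis matrix_mul_assoc)+
  have "B ** ?Y ** B = B" unfolding BY by (rule TU)
  moreover have "?Y ** B ** ?Y = ?Y" unfolding YB using TU(2) by (metis matrix_mul_assoc)
  moreover have "hermitian (E ** B ** ?Y)" using TU(3) BY by (metis matrix_mul_assoc)
  moreover have "hermitian (F ** ?Y ** B)" using TU(4) YB by (metis matrix_mul_assoc)
  ultimately show "\<exists>Y. is_weighted_MP_inverse E F B Y"
    unfolding is_weighted_MP_inverse_def by blast
next
  fix Y Z assume "is_weighted_MP_inverse E F B Y" "is_weighted_MP_inverse E F B Z"
  then have YZ: "Y ** B ** Y = Y" "Z ** B ** Z = Z" "B ** Y = B ** Z" "Y ** B = Z ** B"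
    using inverses_13_unique[OF assms(1,2)] inverses_14_unique[OF assms(3,4)]
    by (auto simp: weighted_MP_iff)
  \<comment> \<open>\<open>Y = Y B Y = Y B Z = Z B Z = Z\<close>.\<close>
  then show "Y = Z" by (metis matrix_mul_assoc)
qed

section \<open>One-sided inverses for the identity weight\<close>

text \<open>The diagonal entries of the product are sums of squared moduli. This definiteness is
  what makes the identity weight work for every matrix.\<close>

lemma ctranspose_mult_self_eq_0:
  assumes "ctranspose N ** N = 0"
  shows "N = 0"
proof -
  have "N $ i $ j = 0" for i j
  proof -
    have "(\<Sum>k\<in>UNIV. cnj (N $ k $ j) * N $ k $ j) = 0"
      using assms by (simp add: vec_eq_iff matrix_matrix_mult_def ctranspose_def)
    then have "complex_of_real (\<Sum>k\<in>UNIV. (norm (N $ k $ j))\<^sup>2) = 0"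
      unfolding of_real_sum complex_norm_square by (simp add: mult.commute)
    then have "(\<Sum>k\<in>UNIV. (norm (N $ k $ j))\<^sup>2) = 0"
      by (simp only: of_real_eq_0_iff)
    then show ?thesis by (simp add: sum_nonneg_eq_0_iff)
  qed
  then show ?thesis by (simp add: vec_eq_iff)
qed

lemma matrix_diff_ldistrib: "A ** (B - C) = A ** B - A ** (C :: 'a::ring_1^_^_)"
  by (simp add: vec_eq_iff matrix_matrix_mult_def right_diff_distrib sum_subtractf)

lemma matrix_diff_rdistrib: "(A - B) ** C = A ** C - B ** (C :: 'a::ring_1^_^_)"
  by (simp add: vec_eq_iff matrix_matrix_mult_def left_diff_distrib sum_subtractf)

text \<open>An inner inverse \<open>G\<close> of \<open>B* B\<close> satisfies
  \<open>B G B* B = B\<close>, because the difference \<open>N\<close> has \<open>B* N = 0\<close>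
  and \<open>N*\<close> is a multiple of \<open>B*\<close>.\<close>

lemma inverses_13_id_nonempty: "inverses_13 (mat 1) B \<noteq> {}"
proof -
  let ?S = "ctranspose B"
  obtain G where G: "?S ** B ** G ** (?S ** B) = ?S ** B"
    using exists_inner_inverse by blast
  let ?N = "B ** G ** ?S ** B - B"
  have "?S ** ?N = 0"
    using G by (simp add: matrix_diff_ldistrib matrix_mul_assoc)
  moreover have "ctranspose ?N = (ctranspose (G ** ?S ** B) - mat 1) ** ?S"
    by (simp add: ctranspose_diff ctranspose_mult matrix_diff_rdistrib matrix_mul_assoc)
  ultimately have "ctranspose ?N ** ?N = 0"
    by (simp add: matrix_mul_assoc[symmetric])
  then have "?N = 0" by (rule ctranspose_mult_self_eq_0)
  then have B: "B ** G ** ?S ** B = B" by simp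
  \<comment> \<open>\<open>T\<close> is \<open>G* B*\<close>, the least-squares inverse, as
    \<open>G*\<close> is again an inner inverse of \<open>B* B\<close>. In this form
    \<open>B ** T\<close> equals \<open>(B T)* (B T)\<close> and is therefore Hermitian.\<close>
  define T where "T = ctranspose (B ** G)"
  have T: "ctranspose T ** ?S ** B = B" unfolding T_def using B by simp
  have BT: "ctranspose (B ** T) = ctranspose T ** ?S" by (simp add: ctranspose_mult)
  have "ctranspose (B ** T) ** (B ** T) = B ** T"
    unfolding BT using T by (simp add: matrix_mul_assoc)
  then have herm: "ctranspose (B ** T) = B ** T"
    by (metis ctranspose_ctranspose ctranspose_mult)
  then have "B ** T ** B = B" using T BT by simp
  with herm show ?thesis by (auto simp: inverses_13_def hermitian_def)
qed

text \<open>Conjugate transposition preserves the identity weight and exchanges the two kinds of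
  inverse.\<close>

lemma inverses_14_id_nonempty: "inverses_14 (mat 1) B \<noteq> {}"
proof -
  obtain T where T: "ctranspose B ** T ** ctranspose B = ctranspose B"
    "ctranspose (ctranspose B ** T) = ctranspose B ** T"
    using inverses_13_id_nonempty[of "ctranspose B"] by (auto simp: inverses_13_def hermitian_def)
  have "B ** ctranspose T ** B = B"
    using T(1) by (metis ctranspose_ctranspose ctranspose_mult matrix_mul_assoc)
  moreover have "ctranspose (ctranspose T ** B) = ctranspose T ** B"
    using T(2) by (metis ctranspose_ctranspose ctranspose_mult)
  ultimately show ?thesis by (auto simp: inverses_14_def hermitian_def)
qed

section \<open>Uniqueness of the weighted core-EP inverse and its Drazin formula\<close>

text \<open>Iterating \<open>X = A X^2\<close> places the range of \<open>X\<close> inside that of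
  every power of \<open>A\<close>, in particular where the equation \<open>X A^(k+1) = A^k\<close>
  applies.\<close>

lemma core_EP_inverse_factor:
  assumes "is_core_EP_inverse E A X"
  shows "X = matpow A j ** matpow X (Suc j)"
proof (induction j)
  case (Suc j)
  have "A ** X ** X = X"
    using assms by (simp add: is_core_EP_inverse_def matpow_2 matrix_mul_assoc)
  moreover have "matpow A (Suc j) ** matpow X (Suc (Suc j)) =
      matpow A j ** (A ** X ** X) ** matpow X j"
    by (simp only: matpow_Suc_right[of A] matpow.simps(2)[of X] matrix_mul_assoc)
  ultimately show ?case using Suc by (simp add: matrix_mul_assoc)
qed simp

text \<open>\<open>X ** A\<close> fixes the range of \<open>A^(ind A)\<close>, which contains that
  of \<open>Y\<close>. So \<open>A ** X\<close> and \<open>A ** Y\<close> absorb each other and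
  coincide, whence \<open>X = X A X = X A Y = Y\<close>.\<close>

lemma core_EP_inverse_unique:
  assumes "invertible E" "hermitian E"
    and X: "is_core_EP_inverse E A X" and Y: "is_core_EP_inverse E A Y"
  shows "X = Y"
proof -
  have absorb: "X ** A ** Y = Y"
    if "is_core_EP_inverse E A X" "is_core_EP_inverse E A Y" for X Y
  proof -
    have "X ** A ** matpow A (ind A) = matpow A (ind A)"
      using that(1) by (simp add: is_core_EP_inverse_def matrix_mul_assoc)
    then show ?thesis
      using core_EP_inverse_factor[OF that(2), of "ind A"] by (metis matrix_mul_assoc)
  qed
  have "A ** X = A ** Y"
  proof (rule weighted_hermitian_eq[OF assms(1,2)])
    show "hermitian (E ** (A ** X))" "hermitian (E ** (A ** Y))"
      using X Y by (simp_all add: is_core_EP_inverse_def matrix_mul_assoc)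
    have "A ** X ** (A ** Y) = A ** Y" "A ** Y ** (A ** X) = A ** X"
      using absorb[OF X Y] absorb[OF Y X] by (metis matrix_mul_assoc)+
    then show "A ** X ** (A ** Y) = A ** Y \<and> A ** Y ** (A ** X) = A ** X \<or>
        A ** X ** (A ** Y) = A ** X \<and> A ** Y ** (A ** X) = A ** Y" by blast
  qed
  then have "X ** A ** X = X ** A ** Y" by (metis matrix_mul_assoc)
  then show ?thesis using absorb[OF X X] absorb[OF X Y] by simp
qed

lemma core_EP_inverse_drazin:
  assumes D: "is_drazin_inverse A D" and m: "ind A \<le> m" and Z: "Z \<in> inverses_13 E (matpow A m)"
  shows "is_core_EP_inverse E A (D ** matpow A m ** Z)"
    and "A ** (D ** matpow A m ** Z) = matpow A m ** Z"
proof -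
  let ?B = "matpow A m" and ?k = "ind A"
  let ?X = "D ** ?B ** Z"
  have BZB: "?B ** Z ** ?B = ?B" and herm: "hermitian (E ** ?B ** Z)"
    using Z by (auto simp: inverses_13_def)
  have DAB: "D ** A ** ?B = ?B"
    using drazin_matpow_Suc[OF D m] by (simp add: matrix_mul_assoc)
  show AX: "A ** ?X = ?B ** Z"
    using DAB drazin_commute[OF D] by (simp add: matrix_mul_assoc)
  have "?X ** matpow A (?k + 1) = matpow A ?k"
  proof -
    \<comment> \<open>\<open>R\<close> exhibits \<open>A^(k+1)\<close> as a right multiple of
      \<open>A^m\<close>: the Drazin factors lower the exponent from \<open>m\<close> to
      \<open>k\<close>, and one \<open>A\<close> is put back. Then \<open>A^m ** Z\<close> acts on
      \<open>A^(k+1)\<close> as the identity.\<close>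
    define R where "R = matpow D (m - ?k) ** A"
    have "?B ** matpow D (m - ?k) = matpow A ?k"
      using matpow_drazin_matpow[OF D order_refl, of "m - ?k"] m by simp
    then have R: "matpow A (?k + 1) = ?B ** R"
      by (simp add: R_def matrix_mul_assoc matpow_commute)
    have "?X ** matpow A (?k + 1) = D ** (?B ** Z ** ?B) ** R"
      by (simp only: R matrix_mul_assoc)
    also have "\<dots> = D ** matpow A (?k + 1)"
      by (simp only: BZB R matrix_mul_assoc)
    finally show ?thesis using drazin_matpow_Suc[OF D order_refl] by simp
  qed
  moreover have "A ** matpow ?X 2 = ?X"
  proof -
    have DB: "D ** ?B = ?B ** D" by (rule matpow_commute[OF drazin_commute[OF D]])
    have "A ** matpow ?X 2 = A ** ?X ** ?X" by (simp only: matpow_2 matrix_mul_assoc)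
    also have "\<dots> = ?B ** Z ** ?X" by (simp only: AX)
    also have "\<dots> = ?B ** Z ** ?B ** D ** Z" by (simp add: DB matrix_mul_assoc)
    finally show ?thesis by (simp add: BZB DB)
  qed
  moreover have "hermitian (E ** A ** ?X)"
    using herm AX by (metis matrix_mul_assoc)
  ultimately show "is_core_EP_inverse E A ?X" unfolding is_core_EP_inverse_def by blast
qed

section \<open>Reduction of the dual notions by transposition\<close>

text \<open>\<open>M F'\<close> is the congruence \<open>F' (F M) F'\<close> by the Hermitian matrix
  \<open>F'\<close>, so it is Hermitian exactly when \<open>F M\<close> is; its transpose is the
  product on the left.\<close>

lemma hermitian_transpose_weight:
  assumes "hermitian F" "F ** F' = mat 1" "F' ** F = mat 1"
  shows "hermitian (transpose F' ** transpose M) \<longleftrightarrow> hermitian (F ** M)"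
proof -
  have F: "ctranspose F = F" using assms by (simp add: hermitian_def)
  have "ctranspose F' ** F = mat 1" using arg_cong[OF assms(2), of ctranspose] F
    by (simp add: ctranspose_mult)
  then have F': "ctranspose F' = F'"
    using assms by (metis matrix_mul_assoc matrix_mul_lid matrix_mul_rid)
  have "hermitian (M ** F') \<longleftrightarrow> F' ** ctranspose M = M ** F'"
    by (simp add: hermitian_def ctranspose_mult F')
  also have "\<dots> \<longleftrightarrow> ctranspose M ** F = F ** M"
    using assms(2,3) by (metis matrix_mul_assoc matrix_mul_lid matrix_mul_rid)
  also have "\<dots> \<longleftrightarrow> hermitian (F ** M)"
    by (simp add: hermitian_def ctranspose_mult F)
  finally show ?thesis
    by (simp add: matrix_transpose_mul[symmetric] hermitian_transpose_iff)
qed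

lemma transpose_mult_eq_iff:
  fixes A B C :: "complex^'n^'n"
  shows "transpose A ** transpose B = transpose C \<longleftrightarrow> B ** A = C"
  by (metis matrix_transpose_mul transpose_transpose)

context
  fixes F F' :: "complex^'n^'n"
  assumes F: "hermitian F" "F ** F' = mat 1" "F' ** F = mat 1"
begin

lemma is_dual_core_EP_inverse_transpose:
  "is_dual_core_EP_inverse F A X \<longleftrightarrow>
    is_core_EP_inverse (transpose F') (transpose A) (transpose X)"
  using hermitian_transpose_weight[OF F, of "X ** A"]
  by (simp add: is_dual_core_EP_inverse_def is_core_EP_inverse_def ind_transpose
      transpose_matpow[symmetric] transpose_mult_eq_iff matrix_transpose_mul matrix_mul_assoc
      del: matpow.simps)

lemma inverses_14_transpose:
  "Y \<in> inverses_14 F B \<longleftrightarrow> transpose Y \<in> inverses_13 (transpose F') (transpose B)"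
  using hermitian_transpose_weight[OF F, of "Y ** B"]
    transpose_mult_eq_iff[of B "B ** Y" B]
  by (simp add: inverses_13_def inverses_14_def matrix_transpose_mul matrix_mul_assoc)

lemma hermitian_transpose_inverse: "invertible (transpose F')" "hermitian (transpose F')"
proof -
  show "invertible (transpose F')"
    unfolding invertible_def using F(2,3) by (metis matrix_transpose_mul transpose_mat)
  show "hermitian (transpose F')"
    \<comment> \<open>For the identity matrix the equivalence compares the two weights
      themselves.\<close>
    using hermitian_transpose_weight[OF F, of "mat 1"] F(1) by (simp add: transpose_mat)
qed

end

text \<open>Transposing moves the inverse to the other side of the power of \<open>A\<close>;
  commutation brings it back.\<close>

lemma is_drazin_inverse_transpose:
  "is_drazin_inverse A X \<Longrightarrow> is_drazin_inverse (transpose A) (transpose X)"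
  unfolding is_drazin_inverse_def ind_transpose transpose_matpow[symmetric]
  using matpow_commute[of X A "ind A + 1"]
  by (metis matrix_mul_assoc matrix_transpose_mul)

lemma dual_core_EP_inverse_unique:
  assumes "invertible F" "hermitian F"
    and "is_dual_core_EP_inverse F A X" "is_dual_core_EP_inverse F A Y"
  shows "X = Y"
proof -
  obtain F' where F': "F ** F' = mat 1" "F' ** F = mat 1"
    using assms(1) by (auto simp: invertible_def)
  note F = assms(2) F'
  have "transpose X = transpose Y"
    using core_EP_inverse_unique[OF hermitian_transpose_inverse[OF F]] assms(3,4)
    unfolding is_dual_core_EP_inverse_transpose[OF F] by blast
  then show ?thesis by (metis transpose_transpose)
qed

lemma dual_core_EP_inverse_drazin:
  assumes "invertible F" "hermitian F"
    and D: "is_drazin_inverse A D" and m: "ind A \<le> m" and Y: "Y \<in> inverses_14 F (matpow A m)"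
  shows "is_dual_core_EP_inverse F A (Y ** matpow A m ** D)"
    and "Y ** matpow A m ** D ** A = Y ** matpow A m"
proof -
  obtain F' where F': "F ** F' = mat 1" "F' ** F = mat 1"
    using assms(1) by (auto simp: invertible_def)
  note F = assms(2) F'
  have "transpose Y \<in> inverses_13 (transpose F') (matpow (transpose A) m)"
    using Y unfolding inverses_14_transpose[OF F] transpose_matpow .
  from core_EP_inverse_drazin[OF is_drazin_inverse_transpose[OF D] _ this]
  have *: "is_core_EP_inverse (transpose F') (transpose A)
      (transpose D ** matpow (transpose A) m ** transpose Y)"
    "transpose A ** (transpose D ** matpow (transpose A) m ** transpose Y) =
      matpow (transpose A) m ** transpose Y"
    using m by (auto simp: ind_transpose)
  have eq: "transpose (Y ** matpow A m ** D) = transpose D ** matpow (transpose A) m ** transpose Y"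
    by (simp add: matrix_transpose_mul transpose_matpow matrix_mul_assoc)
  show "is_dual_core_EP_inverse F A (Y ** matpow A m ** D)"
    unfolding is_dual_core_EP_inverse_transpose[OF F] eq by (rule *)
  show "Y ** matpow A m ** D ** A = Y ** matpow A m"
    using *(2) unfolding eq[symmetric]
    by (metis matrix_transpose_mul transpose_matpow transpose_transpose)
qed

theorem corollary3p15:
  fixes A E F :: "complex^'n^'n" and k m :: nat
  assumes "invertible E" and "hermitian E"
    and "invertible F" and "hermitian F"
    and "ind A = k" and "m \<ge> k"
    and "\<exists>Z. is_weighted_MP_inverse E F (matpow A m) Z"
  shows
    "((\<exists>!X. is_drazin_inverse A X) \<and>
      (\<exists>!X. is_core_EP_inverse E A X) \<and>
      (\<exists>!Z. is_weighted_MP_inverse E (mat 1) (matpow A m) Z) \<and>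
      core_EP_inverse E A =
        drazin_inverse A ** matpow A m ** weighted_MP_inverse E (mat 1) (matpow A m)) \<and>
     (inverses_13 E (matpow A m) \<noteq> {} \<and>
      (\<forall>X \<in> inverses_13 E (matpow A m).
         A ** core_EP_inverse E A = matpow A m ** X \<and>
         matpow A m ** X = matpow A m ** weighted_MP_inverse E (mat 1) (matpow A m))) \<and>
     ((\<exists>!X. is_dual_core_EP_inverse F A X) \<and>
      (\<exists>!Z. is_weighted_MP_inverse (mat 1) F (matpow A m) Z) \<and>
      dual_core_EP_inverse F A =
        weighted_MP_inverse (mat 1) F (matpow A m) ** matpow A m ** drazin_inverse A) \<and>
     (inverses_14 F (matpow A m) \<noteq> {} \<and>
      (\<forall>Y \<in> inverses_14 F (matpow A m).
         dual_core_EP_inverse F A ** A = Y ** matpow A m \<and>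
         Y ** matpow A m = weighted_MP_inverse (mat 1) F (matpow A m) ** matpow A m))"
proof -
  let ?B = "matpow A m"
  note E = assms(1,2) and F = assms(3,4)
  have I: "invertible (mat 1 :: complex^'n^'n)" "hermitian (mat 1 :: complex^'n^'n)"
    by (auto simp: invertible_def hermitian_def)
  have m: "ind A \<le> m" using assms(5,6) by simp
  define D where "D = drazin_inverse A"
  have D_ex1: "\<exists>!X. is_drazin_inverse A X"
    using drazin_inverse_exists drazin_inverse_unique by blast
  then have D: "is_drazin_inverse A D"
    unfolding D_def drazin_inverse_def by (rule theI')
  obtain Z where "Z \<in> inverses_13 E ?B" "Z \<in> inverses_14 F ?B"
    using assms(7) by (auto simp: weighted_MP_iff)
  \<comment> \<open>For each one-sided identity weight, one of the two memberships of
    \<open>Z\<close> is paired with an ordinary one-sided inverse of \<open>A^m\<close>.\<close>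
  then have ne: "inverses_13 E ?B \<noteq> {}" "inverses_14 F ?B \<noteq> {}"
    and ex1: "\<exists>!Z. is_weighted_MP_inverse E (mat 1) ?B Z"
      "\<exists>!Z. is_weighted_MP_inverse (mat 1) F ?B Z"
    using weighted_MP_ex1[OF E I] weighted_MP_ex1[OF I F]
      inverses_13_id_nonempty[of ?B] inverses_14_id_nonempty[of ?B] by blast+
  define Z1 where "Z1 = weighted_MP_inverse E (mat 1) ?B"
  define Z2 where "Z2 = weighted_MP_inverse (mat 1) F ?B"
  have Z1: "Z1 \<in> inverses_13 E ?B"
    using theI'[OF ex1(1)] unfolding Z1_def weighted_MP_inverse_def weighted_MP_iff by blast
  have Z2: "Z2 \<in> inverses_14 F ?B"
    using theI'[OF ex1(2)] unfolding Z2_def weighted_MP_inverse_def weighted_MP_iff by blast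
  note X1 = core_EP_inverse_drazin[OF D m Z1]
  note X2 = dual_core_EP_inverse_drazin[OF F D m Z2]
  have core_ex1: "\<exists>!X. is_core_EP_inverse E A X"
    using X1(1) core_EP_inverse_unique[OF E] by blast
  have dual_ex1: "\<exists>!X. is_dual_core_EP_inverse F A X"
    using X2(1) dual_core_EP_inverse_unique[OF F] by blast
  have core: "core_EP_inverse E A = D ** ?B ** Z1"
    unfolding core_EP_inverse_def using core_ex1 X1(1) by (rule the1_equality)
  have dual: "dual_core_EP_inverse F A = Z2 ** ?B ** D"
    unfolding dual_core_EP_inverse_def using dual_ex1 X2(1) by (rule the1_equality)
  \<comment> \<open>The equality holds for \<open>Z1\<close> by \<open>X1\<close>; it passes to an
    arbitrary \<open>X\<close> since all elements of \<open>A^m{1,3^E}\<close> have the same product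
    with \<open>A^m\<close>.\<close>
  have "A ** core_EP_inverse E A = ?B ** X \<and> ?B ** X = ?B ** Z1" if "X \<in> inverses_13 E ?B" for X
    unfolding core X1(2) using inverses_13_unique[OF E that Z1] by simp
  moreover have "dual_core_EP_inverse F A ** A = Y ** ?B \<and> Y ** ?B = Z2 ** ?B"
    if "Y \<in> inverses_14 F ?B" for Y
    unfolding dual X2(2) using inverses_14_unique[OF F that Z2] by simp
  ultimately show ?thesis
    using D_ex1 core_ex1 dual_ex1 ex1 ne core dual
    unfolding D_def[symmetric] Z1_def[symmetric] Z2_def[symmetric] by blast
qed

end
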